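(* Let $\mathcal A$ be a real associative commutative algebra admitting a non-degenerate symmetric bilinear form $B:\mathcal A\times\mathcal A\to\mathbb R$ such that $B(ab,c)=B(b,ac)$ for all $a,b,c\in\mathcal A$, and let $(\mathfrak g,J,\varphi)$ be a pseudo-Hermitian quadratic Lie algebra. Then the tensor product $\mathfrak G=\mathfrak g\otimes_{\mathbb R}\mathcal A$ with the bracket, complex structure $J'$ and bilinear form $\phi$ defined (by linear, resp. bilinear, extension) by $$[x\otimes a,y\otimes b]_{\mathfrak G}=[x,y]\otimes ab,\quad J'(x\otimes a)=Jx\otimes a,\quad \phi(x\otimes a,y\otimes b)=\varphi(x,y)B(a,b),$$ for every $x,y\in\mathfrak g$, $a,b\in\mathcal A$, is a pseudo-Hermitian quadratic Lie algebra.
   Context: All Lie algebras are real. A complex structure on a Lie algebra $\mathfrak g$ is a linear map $J:\mathfrak g\to\mathfrak g$ with $J^2=-I$ and $[x,y]+J[Jx,y]+J[x,Jy]-[Jx,Jy]=0$ for all $x,y$. A pseudo-Hermitian quadratic Lie algebra is a triple $(\mathfrak g,J,\varphi)$ where $J$ is a complex structure and $\varphi$ is a non-degenerate symmetric bilinear form with $\varphi([x,y],z)+\varphi(y,[x,z])=0$ and $\varphi(Jx,Jy)=\varphi(x,y)$ for all $x,y,z$. The algebra $\mathcal A$ is not required to have a unit. *)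

theory Defs
  imports "HOL-Analysis.Analysis" "HOL-Analysis.Finite_Function_Topology"
begin

section \<open>The tensor product of two real vector spaces\<close>

text \<open>
  The quotient of the free real vector space on the set of all pairs by the subspace spanned
  by the bilinearity relations.
\<close>

abbreviation free_pair :: "'u \<Rightarrow> 'v \<Rightarrow> ('u \<times> 'v) \<Rightarrow>\<^sub>0 real" where
  "free_pair x a \<equiv> Poly_Mapping.single (x, a) 1"

definition tensor_relations :: "(('u::real_vector \<times> 'v::real_vector) \<Rightarrow>\<^sub>0 real) set" where
  "tensor_relations =
     {free_pair (x + y) a - free_pair x a - free_pair y a | x y a. True}
   \<union> {free_pair x (a + b) - free_pair x a - free_pair x b | x a b. True}
   \<union> {free_pair (r *\<^sub>R x) a - r *\<^sub>R free_pair x a | r x a. True}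
   \<union> {free_pair x (r *\<^sub>R a) - r *\<^sub>R free_pair x a | r x a. True}"

definition tensor_eq ::
  "(('u::real_vector \<times> 'v::real_vector) \<Rightarrow>\<^sub>0 real) \<Rightarrow> (('u \<times> 'v) \<Rightarrow>\<^sub>0 real) \<Rightarrow> bool" where
  "tensor_eq p q \<longleftrightarrow> p - q \<in> span tensor_relations"

lemma tensor_eq_equivp: "equivp tensor_eq"
proof (rule equivpI)
  show "reflp tensor_eq"
    by (auto simp: reflp_def tensor_eq_def span_zero)
  show "symp tensor_eq"
    unfolding symp_def tensor_eq_def by (metis minus_diff_eq span_neg)
  show "transp tensor_eq"
  proof (rule transpI)
    fix p q s
    assume "tensor_eq p q" "tensor_eq q s"
    then show "tensor_eq p s"
      using span_add[of "p - q" tensor_relations "q - s"] by (simp add: tensor_eq_def)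
  qed
qed

quotient_type (overloaded) ('u, 'v) tensor_product =
  "('u::real_vector \<times> 'v::real_vector) \<Rightarrow>\<^sub>0 real" / tensor_eq
  by (rule tensor_eq_equivp)

instantiation tensor_product :: (real_vector, real_vector) real_vector
begin

lift_definition zero_tensor_product :: "('a, 'b) tensor_product" is 0 .

lift_definition plus_tensor_product ::
  "('a, 'b) tensor_product \<Rightarrow> ('a, 'b) tensor_product \<Rightarrow> ('a, 'b) tensor_product" is "(+)"
  unfolding tensor_eq_def by (simp only: add_diff_add span_add)

lift_definition uminus_tensor_product ::
  "('a, 'b) tensor_product \<Rightarrow> ('a, 'b) tensor_product" is uminus
  unfolding tensor_eq_def by (simp only: minus_diff_minus span_neg)

lift_definition minus_tensor_product ::
  "('a, 'b) tensor_product \<Rightarrow> ('a, 'b) tensor_product \<Rightarrow> ('a, 'b) tensor_product" is "(-)"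
proof -
  fix p p' q q' :: "('a \<times> 'b) \<Rightarrow>\<^sub>0 real"
  assume "tensor_eq p p'" "tensor_eq q q'"
  then have "(p - p') - (q - q') \<in> span tensor_relations"
    unfolding tensor_eq_def by (rule span_diff)
  moreover have "(p - p') - (q - q') = (p - q) - (p' - q')" by simp
  ultimately show "tensor_eq (p - q) (p' - q')"
    unfolding tensor_eq_def by simp
qed

lift_definition scaleR_tensor_product ::
  "real \<Rightarrow> ('a, 'b) tensor_product \<Rightarrow> ('a, 'b) tensor_product" is "(*\<^sub>R)"
  unfolding tensor_eq_def by (simp only: scaleR_right_diff_distrib[symmetric] span_scale)

instance
proof
  fix p q s :: "('a, 'b) tensor_product" and r t :: real
  have eqI: "tensor_eq u v" if "u = v" for u v :: "('a \<times> 'b) \<Rightarrow>\<^sub>0 real"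
    using that by (simp add: tensor_eq_def span_zero)
  show "p + q + s = p + (q + s)" by transfer (simp add: eqI add.assoc)
  show "p + q = q + p" by transfer (simp add: eqI add.commute)
  show "0 + p = p" by transfer (simp add: eqI)
  show "- p + p = 0" by transfer (simp add: eqI)
  show "p - q = p + - q" by transfer (simp add: eqI)
  show "r *\<^sub>R (p + q) = r *\<^sub>R p + r *\<^sub>R q" by transfer (simp add: eqI scaleR_right_distrib)
  show "(r + t) *\<^sub>R p = r *\<^sub>R p + t *\<^sub>R p" by transfer (simp add: eqI scaleR_left_distrib)
  show "r *\<^sub>R t *\<^sub>R p = (r * t) *\<^sub>R p" by transfer (simp add: eqI)
  show "1 *\<^sub>R p = p" by transfer (simp add: eqI)
qed

end

lift_definition pure_tensor ::
  "'u::real_vector \<Rightarrow> 'v::real_vector \<Rightarrow> ('u, 'v) tensor_product" (infixl "\<otimes>" 75)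
  is free_pair .

lemma bilinear_pure_tensor: "bilinear (\<otimes>)"
proof -
  have "(x + y) \<otimes> a = x \<otimes> a + y \<otimes> a" for x y :: 'a and a :: 'b
  proof transfer
    fix x y :: 'a and a :: 'b
    have "free_pair (x + y) a - free_pair x a - free_pair y a \<in> span tensor_relations"
      by (rule span_base) (unfold tensor_relations_def, blast)
    then show "tensor_eq (free_pair (x + y) a) (free_pair x a + free_pair y a)"
      unfolding tensor_eq_def by (simp only: diff_diff_eq)
  qed
  moreover have "x \<otimes> (a + b) = x \<otimes> a + x \<otimes> b" for x :: 'a and a b :: 'b
  proof transfer
    fix x :: 'a and a b :: 'b
    have "free_pair x (a + b) - free_pair x a - free_pair x b \<in> span tensor_relations"
      by (rule span_base) (unfold tensor_relations_def, blast)
    then show "tensor_eq (free_pair x (a + b)) (free_pair x a + free_pair x b)"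
      unfolding tensor_eq_def by (simp only: diff_diff_eq)
  qed
  moreover have "(r *\<^sub>R x) \<otimes> a = r *\<^sub>R (x \<otimes> a)" for r and x :: 'a and a :: 'b
    by (transfer, unfold tensor_eq_def, rule span_base) (unfold tensor_relations_def, blast)
  moreover have "x \<otimes> (r *\<^sub>R a) = r *\<^sub>R (x \<otimes> a)" for r and x :: 'a and a :: 'b
    by (transfer, unfold tensor_eq_def, rule span_base) (unfold tensor_relations_def, blast)
  ultimately show ?thesis
    by (auto simp: bilinear_def intro!: linearI)
qed

lemma lookup_scaleR_poly_mapping:
  "Poly_Mapping.lookup (r *\<^sub>R p) k = r *\<^sub>R Poly_Mapping.lookup p k"
  for p :: "'k \<Rightarrow>\<^sub>0 'b::real_vector"
proof -
  have "finite {i. r *\<^sub>R Poly_Mapping.lookup p i \<noteq> 0}"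
    by (rule finite_subset[OF _ finite_lookup[of p]]) auto
  then show ?thesis
    by (simp add: scaleR_poly_mapping_def)
qed

definition free_lift :: "('k \<Rightarrow> 'w::real_vector) \<Rightarrow> ('k \<Rightarrow>\<^sub>0 real) \<Rightarrow> 'w" where
  "free_lift f p = (\<Sum>k\<in>Poly_Mapping.keys p. Poly_Mapping.lookup p k *\<^sub>R f k)"

lemma free_lift_superset:
  assumes "finite S" "Poly_Mapping.keys p \<subseteq> S"
  shows "free_lift f p = (\<Sum>k\<in>S. Poly_Mapping.lookup p k *\<^sub>R f k)"
  unfolding free_lift_def
  by (rule sum.mono_neutral_left) (use assms in \<open>auto simp: in_keys_iff\<close>)

lemma linear_free_lift: "linear (free_lift f)"
proof (rule linearI)
  fix p q :: "'a \<Rightarrow>\<^sub>0 real" and r :: real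
  let ?S = "Poly_Mapping.keys p \<union> Poly_Mapping.keys q"
  have "free_lift f (p + q) = (\<Sum>k\<in>?S. Poly_Mapping.lookup (p + q) k *\<^sub>R f k)"
    by (rule free_lift_superset) (simp_all add: keys_add)
  also have "\<dots> = free_lift f p + free_lift f q"
    by (simp add: free_lift_superset[of ?S] lookup_add scaleR_left_distrib sum.distrib)
  finally show "free_lift f (p + q) = free_lift f p + free_lift f q" .
  have "free_lift f (r *\<^sub>R p)
      = (\<Sum>k\<in>Poly_Mapping.keys p. Poly_Mapping.lookup (r *\<^sub>R p) k *\<^sub>R f k)"
    by (rule free_lift_superset) (auto simp: in_keys_iff lookup_scaleR_poly_mapping)
  then show "free_lift f (r *\<^sub>R p) = r *\<^sub>R free_lift f p"
    by (simp add: free_lift_def lookup_scaleR_poly_mapping scaleR_sum_right)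
qed

lemma free_lift_single [simp]: "free_lift f (Poly_Mapping.single k 1) = f k"
  by (simp add: free_lift_def)

lemma span_free_generators: "span (range (\<lambda>k. Poly_Mapping.single k (1::real))) = UNIV"
proof -
  have "p = (\<Sum>k\<in>Poly_Mapping.keys p. Poly_Mapping.lookup p k *\<^sub>R Poly_Mapping.single k 1)"
    for p :: "'a \<Rightarrow>\<^sub>0 real"
  proof (rule poly_mapping_eqI)
    fix i
    have "(\<Sum>k\<in>Poly_Mapping.keys p. Poly_Mapping.lookup p k * (if k = i then 1 else 0))
        = Poly_Mapping.lookup p i"
      by (simp add: if_distrib[of "\<lambda>x. _ * x"] sum.delta in_keys_iff cong: if_cong)
    then show "Poly_Mapping.lookup p i = Poly_Mapping.lookup
        (\<Sum>k\<in>Poly_Mapping.keys p. Poly_Mapping.lookup p k *\<^sub>R Poly_Mapping.single k 1) i"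
      by (simp add: lookup_sum lookup_scaleR_poly_mapping lookup_single when_def)
  qed
  then have "p \<in> span (range (\<lambda>k. Poly_Mapping.single k 1))" for p :: "'a \<Rightarrow>\<^sub>0 real"
    by (metis (no_types, lifting) rangeI span_base span_scale span_sum)
  then show ?thesis by blast
qed

lemma span_pure_tensors:
  "span {x \<otimes> a | x a. True} = (UNIV :: ('u::real_vector, 'v::real_vector) tensor_product set)"
proof -
  have lin: "linear (abs_tensor_product :: _ \<Rightarrow> ('u, 'v) tensor_product)"
    by (rule linearI) (simp_all add: plus_tensor_product.abs_eq scaleR_tensor_product.abs_eq)
  let ?G = "{x \<otimes> a | x a. True} :: ('u, 'v) tensor_product set"
  have gen: "abs_tensor_product ` range (\<lambda>k. Poly_Mapping.single k 1) = ?G"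
    by (auto simp: pure_tensor.abs_eq image_iff)
  have "span ?G = abs_tensor_product ` UNIV"
    using linear_span_image[OF lin, of "range (\<lambda>k. Poly_Mapping.single k 1)"]
    by (simp add: gen span_free_generators)
  also have "\<dots> = UNIV"
    using Quotient3_abs_rep[OF Quotient3_tensor_product] by (metis surj_def)
  finally show ?thesis .
qed

theorem tensor_product_universal:
  fixes f :: "'u::real_vector \<Rightarrow> 'v::real_vector \<Rightarrow> 'w::real_vector"
  assumes "bilinear f"
  shows "\<exists>!h. linear h \<and> (\<forall>x a. h (x \<otimes> a) = f x a)"
proof (rule ex_ex1I)
  let ?L = "free_lift (case_prod f)"
  interpret L: linear ?L by (rule linear_free_lift)
  have gens: "?L p = 0" if "p \<in> tensor_relations" for p
    using that assms
    by (auto simp: tensor_relations_def L.diff L.scale bilinear_ladd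
        bilinear_radd bilinear_lmul bilinear_rmul)
  have zero: "?L p = 0" if "p \<in> span tensor_relations" for p
    by (rule linear_eq_0_on_span[OF linear_free_lift gens that])
  have resp: "?L p = ?L q" if "tensor_eq p q" for p q
    using zero[of "p - q"] that by (simp add: tensor_eq_def L.diff)
  define h where "h t = ?L (rep_tensor_product t)" for t
  have h_abs: "h (abs_tensor_product p) = ?L p" for p
    unfolding h_def
    by (rule resp, rule rep_abs_rsp_left[OF Quotient3_tensor_product])
      (simp add: tensor_eq_def span_zero)
  have surj: "\<exists>p. t = abs_tensor_product p" for t :: "('u, 'v) tensor_product"
    using Quotient3_abs_rep[OF Quotient3_tensor_product] by metis
  have "linear h"
  proof (rule linearI)
    fix s t :: "('u, 'v) tensor_product" and r :: real
    obtain p q where "s = abs_tensor_product p" "t = abs_tensor_product q"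
      using surj by metis
    then show "h (s + t) = h s + h t" "h (r *\<^sub>R s) = r *\<^sub>R h s"
      by (simp_all add: plus_tensor_product.abs_eq scaleR_tensor_product.abs_eq h_abs L.add L.scale)
  qed
  moreover have "h (x \<otimes> a) = f x a" for x a
    by (simp add: pure_tensor.abs_eq h_abs)
  ultimately show "\<exists>h. linear h \<and> (\<forall>x a. h (x \<otimes> a) = f x a)" by blast
next
  fix h k :: "('u, 'v) tensor_product \<Rightarrow> 'w"
  assume h: "linear h \<and> (\<forall>x a. h (x \<otimes> a) = f x a)"
    and k: "linear k \<and> (\<forall>x a. k (x \<otimes> a) = f x a)"
  show "h = k"
  proof
    fix t :: "('u, 'v) tensor_product"
    have "t \<in> span {x \<otimes> a | x a. True}"
      by (simp only: span_pure_tensors UNIV_I)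
    then show "h t = k t"
      by (rule linear_eq_on[OF conjunct1[OF h] conjunct1[OF k]]) (use h k in auto)
  qed
qed


section \<open>Pseudo-Hermitian quadratic Lie algebras\<close>

text \<open>The underlying vector spaces are not assumed to be finite-dimensional.\<close>

locale lie_algebra =
  fixes bracket :: "'g::real_vector \<Rightarrow> 'g \<Rightarrow> 'g"
  assumes bilinear_bracket: "bilinear bracket"
    and bracket_self: "bracket x x = 0"
    and jacobi: "bracket x (bracket y z) + bracket y (bracket z x) + bracket z (bracket x y) = 0"

locale lie_algebra_complex_structure = lie_algebra bracket
  for bracket :: "'g::real_vector \<Rightarrow> 'g \<Rightarrow> 'g" +
  fixes J :: "'g \<Rightarrow> 'g"
  assumes linear_J: "linear J"
    and J_J: "J (J x) = - x"
    and integrable_J: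
      "bracket x y + J (bracket (J x) y) + J (bracket x (J y)) - bracket (J x) (J y) = 0"

text \<open>
  For symmetric forms this one-sided condition is symmetric. It only says that the radical
  vanishes, also in infinite dimension.
\<close>

definition nondegenerate :: "('v::real_vector \<Rightarrow> 'v \<Rightarrow> real) \<Rightarrow> bool" where
  "nondegenerate B \<longleftrightarrow> (\<forall>x. (\<forall>y. B x y = 0) \<longrightarrow> x = 0)"

locale nondegenerate_symmetric_form =
  fixes form :: "'v::real_vector \<Rightarrow> 'v \<Rightarrow> real"
  assumes bilinear_form: "bilinear form"
    and form_sym: "form x y = form y x"
    and nondegenerate_form: "nondegenerate form"

locale pseudo_hermitian_quadratic_lie_algebra =
  lie_algebra_complex_structure bracket J + nondegenerate_symmetric_form form
  for bracket :: "'g::real_vector \<Rightarrow> 'g \<Rightarrow> 'g" and J :: "'g \<Rightarrow> 'g" and form :: "'g \<Rightarrow> 'g \<Rightarrow> real" +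
  assumes form_invariant: "form (bracket x y) z + form y (bracket x z) = 0"
    and form_J: "form (J x) (J y) = form x y"


section \<open>The structure maps on the tensor product\<close>

text \<open>
  The sort \<open>{real_algebra, comm_ring}\<close> is that of commutative associative real algebras, not
  necessarily with unit. The predicates below single out the linear or bilinear map with the
  given values on pure tensors.
\<close>

definition is_tensor_bracket ::
  "('g::real_vector \<Rightarrow> 'g \<Rightarrow> 'g) \<Rightarrow>
   (('g, 'a::{real_algebra, comm_ring}) tensor_product \<Rightarrow> ('g, 'a) tensor_product
     \<Rightarrow> ('g, 'a) tensor_product) \<Rightarrow> bool" where
  "is_tensor_bracket bracket bracket' \<longleftrightarrow>
     bilinear bracket' \<and>
     (\<forall>x y a b. bracket' (x \<otimes> a) (y \<otimes> b) = bracket x y \<otimes> (a * b))"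

definition is_tensor_complex_structure ::
  "('g::real_vector \<Rightarrow> 'g) \<Rightarrow>
   (('g, 'a::real_vector) tensor_product \<Rightarrow> ('g, 'a) tensor_product) \<Rightarrow> bool" where
  "is_tensor_complex_structure J J' \<longleftrightarrow>
     linear J' \<and> (\<forall>x a. J' (x \<otimes> a) = J x \<otimes> a)"

definition is_tensor_form ::
  "('g::real_vector \<Rightarrow> 'g \<Rightarrow> real) \<Rightarrow> ('a::real_vector \<Rightarrow> 'a \<Rightarrow> real) \<Rightarrow>
   (('g, 'a) tensor_product \<Rightarrow> ('g, 'a) tensor_product \<Rightarrow> real) \<Rightarrow> bool" where
  "is_tensor_form \<phi> B \<phi>' \<longleftrightarrow>
     bilinear \<phi>' \<and> (\<forall>x y a b. \<phi>' (x \<otimes> a) (y \<otimes> b) = \<phi> x y * B a b)"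

end

theory Submission
  imports Defs
begin

text \<open>
  Apart from non-degeneracy, everything reduces to pure tensors. A map that is linear in each tensor argument is
  determined by its values there, and the universal property of the tensor product, applied
  once in each argument (\<open>tensor_bilinear_extension\<close>), produces bilinear maps with prescribed
  values. This gives existence and uniqueness of the three structure maps. The identities
  required of them are additive in each argument (\<open>[t, t] = 0\<close> once it is replaced by skew
  symmetry), hence follow from the case of pure tensors. There the products of elements of \<open>\<A>\<close>,
  or the values of \<open>B\<close>, are the same in all terms of the identity, so that they factor out and
  leave the corresponding identity in \<open>\<gg>\<close>: for the Jacobi identity
  \<open>a (b c) = b (c a) = c (a b)\<close>, and for the invariance of the form \<open>B (a b) c = B b (a c)\<close>.

  Non-degeneracy cannot be tested on pure tensors. Here a
  tensor is written as a finite sum \<open>\<Sum> f e \<otimes> e\<close> over linearly independent elements \<open>e\<close> of \<open>\<A>\<close>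
  (\<open>tensor_basis_expansion\<close>). If it is orthogonal to all \<open>y \<otimes> b\<close>, then \<open>\<Sum> \<phi> (f e) y e\<close> lies
  in the radical of \<open>B\<close> and so vanishes; independence gives \<open>\<phi> (f e) y = 0\<close> for all \<open>y\<close>,
  and non-degeneracy of \<open>\<phi>\<close> gives \<open>f e = 0\<close>.
\<close>

section \<open>Linear and bilinear maps on tensor products\<close>

lemmas bilinear_simps =
  bilinear_ladd bilinear_radd bilinear_lmul bilinear_rmul bilinear_lneg bilinear_rneg
  bilinear_lzero bilinear_rzero

lemma bilinear_compose_linear:
  assumes "bilinear f" "linear g" "linear h"
  shows "bilinear (\<lambda>x y. f (g x) (h y))"
  using assms by (auto simp: bilinear_def intro: linear_compose[unfolded o_def])

text \<open>There is no case for scalar multiples, since a scalar can be absorbed into a factor.\<close>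

lemma tensor_induct [case_names zero pure add]:
  fixes t :: "('u::real_vector, 'v::real_vector) tensor_product"
  assumes "P 0" and "\<And>x a. P (x \<otimes> a)" and "\<And>s t. P s \<Longrightarrow> P t \<Longrightarrow> P (s + t)"
  shows "P t"
proof -
  have "t \<in> span {x \<otimes> a | x a. True}"
    by (simp only: span_pure_tensors UNIV_I)
  then show ?thesis
  proof (induction rule: span_induct_alt)
    case (step c u s)
    then obtain x a where "u = x \<otimes> a"
      by blast
    then have "c *\<^sub>R u = (c *\<^sub>R x) \<otimes> a"
      by (simp add: bilinear_lmul[OF bilinear_pure_tensor])
    then show ?case
      using assms step by simp
  qed (rule assms)
qed

lemma linear_eq_on_pure_tensors:
  fixes h k :: "('u::real_vector, 'v::real_vector) tensor_product \<Rightarrow> 'w::real_vector"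
  assumes "linear h" "linear k" "\<And>x a. h (x \<otimes> a) = k (x \<otimes> a)"
  shows "h t = k t"
  by (induction t rule: tensor_induct)
    (simp_all add: assms linear_0[OF assms(1)] linear_0[OF assms(2)] linear_add[OF assms(1)]
      linear_add[OF assms(2)])

lemma bilinear_eq_on_pure_tensors:
  fixes F G :: "('u::real_vector, 'v::real_vector) tensor_product \<Rightarrow>
    ('x::real_vector, 'y::real_vector) tensor_product \<Rightarrow> 'w::real_vector"
  assumes "bilinear F" "bilinear G"
    and "\<And>x a y b. F (x \<otimes> a) (y \<otimes> b) = G (x \<otimes> a) (y \<otimes> b)"
  shows "F s t = G s t"
proof (rule linear_eq_on_pure_tensors[of "\<lambda>s. F s t" "\<lambda>s. G s t"])
  show "F (x \<otimes> a) t = G (x \<otimes> a) t" for x a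
    by (rule linear_eq_on_pure_tensors) (use assms in \<open>auto simp: bilinear_def\<close>)
qed (use assms in \<open>auto simp: bilinear_def\<close>)

text \<open>
  The universal property in the second argument extends \<open>F x a\<close> to a linear map \<open>h x a\<close>; since
  \<open>h x a t\<close> is still bilinear in \<open>(x, a)\<close> for every \<open>t\<close>, the universal property applies again.
\<close>

lemma tensor_bilinear_extension:
  fixes F :: "'u::real_vector \<Rightarrow> 'v::real_vector \<Rightarrow> 'x::real_vector \<Rightarrow> 'y::real_vector \<Rightarrow>
    'w::real_vector"
  assumes right: "\<And>x a. bilinear (F x a)"
    and left: "\<And>y b. bilinear (\<lambda>x a. F x a y b)"
  shows "\<exists>!F'. bilinear F' \<and> (\<forall>x y a b. F' (x \<otimes> a) (y \<otimes> b) = F x a y b)"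
proof (rule ex_ex1I)
  have "\<exists>h. linear h \<and> (\<forall>y b. h (y \<otimes> b) = F x a y b)" for x a
    using tensor_product_universal[OF right] by (rule ex1_implies_ex)
  then obtain h where h: "linear (h x a)" "h x a (y \<otimes> b) = F x a y b" for x a y b
    by metis
  note h_linear = linear_0[OF h(1)] linear_add[OF h(1)]
  have "bilinear (\<lambda>x a. h x a t)" for t
  proof (induction t rule: tensor_induct)
    case zero
    show ?case
      by (simp add: h_linear bilinear_def linear_iff)
  next
    case (pure y b)
    show ?case
      using left by (simp add: h)
  next
    case (add s t)
    then show ?case
      by (simp add: h_linear bilinear_def linear_compose_add)
  qed
  then have "\<exists>k. linear k \<and> (\<forall>x a. k (x \<otimes> a) = h x a t)" for t
    by (intro ex1_implies_ex tensor_product_universal)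
  then obtain k where k: "linear (k t)" "k t (x \<otimes> a) = h x a t" for t x a
    by metis
  have "k (s + t) r = k s r + k t r" for s t r
    by (rule linear_eq_on_pure_tensors) (simp_all add: k linear_compose_add h_linear)
  moreover have "k (c *\<^sub>R t) r = c *\<^sub>R k t r" for c t r
    by (rule linear_eq_on_pure_tensors)
      (simp_all add: k linear_compose_scale_right linear_scale[OF h(1)])
  ultimately have "bilinear (\<lambda>s t. k t s)"
    by (auto simp: bilinear_def k intro: linearI)
  then show "\<exists>F'. bilinear F' \<and> (\<forall>x y a b. F' (x \<otimes> a) (y \<otimes> b) = F x a y b)"
    using h k by (intro exI[of _ "\<lambda>s t. k t s"]) simp
next
  fix G H :: "('u, 'v) tensor_product \<Rightarrow> ('x, 'y) tensor_product \<Rightarrow> 'w"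
  assume "bilinear G \<and> (\<forall>x y a b. G (x \<otimes> a) (y \<otimes> b) = F x a y b)"
    and "bilinear H \<and> (\<forall>x y a b. H (x \<otimes> a) (y \<otimes> b) = F x a y b)"
  then have "G s t = H s t" for s t
    by - (rule bilinear_eq_on_pure_tensors, auto)
  then show "G = H"
    by blast
qed

lemma ex1_tensor_bracket:
  fixes bracket :: "'g::real_vector \<Rightarrow> 'g \<Rightarrow> 'g"
  assumes "bilinear bracket"
  shows "\<exists>!bracket' :: ('g, 'a::{real_algebra, comm_ring}) tensor_product \<Rightarrow>
    ('g, 'a) tensor_product \<Rightarrow> ('g, 'a) tensor_product. is_tensor_bracket bracket bracket'"
  unfolding is_tensor_bracket_def
  by (rule tensor_bilinear_extension[where F = "\<lambda>x a y b. bracket x y \<otimes> (a * b)"])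
    (simp_all add: bilinear_def linear_iff bilinear_simps[OF assms]
      bilinear_simps[OF bilinear_pure_tensor] algebra_simps)

lemma ex1_tensor_complex_structure:
  fixes J :: "'g::real_vector \<Rightarrow> 'g"
  assumes "linear J"
  shows "\<exists>!J' :: ('g, 'a::real_vector) tensor_product \<Rightarrow> ('g, 'a) tensor_product.
    is_tensor_complex_structure J J'"
  unfolding is_tensor_complex_structure_def
  by (rule tensor_product_universal)
    (use bilinear_compose_linear[OF bilinear_pure_tensor assms linear_id] in \<open>simp add: id_def\<close>)

lemma ex1_tensor_form:
  fixes \<phi> :: "'g::real_vector \<Rightarrow> 'g \<Rightarrow> real" and B :: "'a::real_vector \<Rightarrow> 'a \<Rightarrow> real"
  assumes "bilinear \<phi>" "bilinear B"
  shows "\<exists>!\<phi>'. is_tensor_form \<phi> B \<phi>'"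
  unfolding is_tensor_form_def
  by (rule tensor_bilinear_extension[where F = "\<lambda>x a y b. \<phi> x y * B a b"])
    (simp_all add: bilinear_def linear_iff bilinear_simps[OF assms(1)]
      bilinear_simps[OF assms(2)] algebra_simps)

section \<open>Non-degeneracy of the tensor product of two forms\<close>

text \<open>
  Taking \<open>E\<close> to be a basis chosen beforehand, rather than making a given sum of pure tensors
  as short as possible, makes this an induction: two expansions are added after extending their
  coefficients by zero to the union of the index sets.
\<close>

lemma tensor_basis_expansion:
  fixes t :: "('u::real_vector, 'v::real_vector) tensor_product"
  assumes E: "independent E" "span E = UNIV"
  obtains S f where "finite S" "S \<subseteq> E" "t = (\<Sum>e\<in>S. f e \<otimes> e)"
proof -
  have "\<exists>S f. finite S \<and> S \<subseteq> E \<and> t = (\<Sum>e\<in>S. f e \<otimes> e)"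
  proof (induction t rule: tensor_induct)
    case zero
    show ?case
      by (rule exI[of _ "{}"]) simp
  next
    case (pure x a)
    let ?c = "representation E a"
    let ?S = "{e. ?c e \<noteq> 0}"
    have "a = (\<Sum>e\<in>?S. ?c e *\<^sub>R e)"
      using E by (simp add: sum_nonzero_representation_eq)
    then have "x \<otimes> a = x \<otimes> (\<Sum>e\<in>?S. ?c e *\<^sub>R e)"
      by simp
    also have "\<dots> = (\<Sum>e\<in>?S. x \<otimes> (?c e *\<^sub>R e))"
    proof (rule linear_sum)
      have "bilinear ((\<otimes>) :: 'u \<Rightarrow> 'v \<Rightarrow> _)"
        by (rule bilinear_pure_tensor)
      then show "linear ((\<otimes>) x :: 'v \<Rightarrow> _)"
        by (simp add: bilinear_def)
    qed
    also have "\<dots> = (\<Sum>e\<in>?S. (?c e *\<^sub>R x) \<otimes> e)"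
      by (simp add: bilinear_simps[OF bilinear_pure_tensor])
    finally have "x \<otimes> a = (\<Sum>e\<in>?S. (?c e *\<^sub>R x) \<otimes> e)" .
    then show ?case
      by (intro exI[of _ ?S] exI[of _ "\<lambda>e. ?c e *\<^sub>R x"])
        (auto intro: finite_representation representation_ne_zero)
  next
    case (add s t)
    then obtain S f T g where st: "finite S" "S \<subseteq> E" "s = (\<Sum>e\<in>S. f e \<otimes> e)"
      "finite T" "T \<subseteq> E" "t = (\<Sum>e\<in>T. g e \<otimes> e)"
      by blast
    let ?f = "\<lambda>e. if e \<in> S then f e else 0" and ?g = "\<lambda>e. if e \<in> T then g e else 0"
    have "s = (\<Sum>e\<in>S \<union> T. ?f e \<otimes> e)"
      unfolding st by (rule sum.mono_neutral_cong_left)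
        (use st in \<open>auto simp: bilinear_simps[OF bilinear_pure_tensor]\<close>)
    moreover have "t = (\<Sum>e\<in>S \<union> T. ?g e \<otimes> e)"
      unfolding st by (rule sum.mono_neutral_cong_left)
        (use st in \<open>auto simp: bilinear_simps[OF bilinear_pure_tensor]\<close>)
    ultimately have "s + t = (\<Sum>e\<in>S \<union> T. (?f e + ?g e) \<otimes> e)"
      by (simp only: bilinear_simps[OF bilinear_pure_tensor] sum.distrib)
    then show ?case
      using st by (intro exI[of _ "S \<union> T"] exI[of _ "\<lambda>e. ?f e + ?g e"]) simp
  qed
  then show ?thesis
    using that by blast
qed

lemma nondegenerate_tensor_form:
  fixes \<phi> :: "'g::real_vector \<Rightarrow> 'g \<Rightarrow> real" and B :: "'a::real_vector \<Rightarrow> 'a \<Rightarrow> real"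
  assumes nd: "nondegenerate \<phi>" "nondegenerate B" and B: "bilinear B"
    and form: "is_tensor_form \<phi> B \<phi>'"
  shows "nondegenerate \<phi>'"
  unfolding nondegenerate_def
proof (intro allI impI)
  fix t
  assume orth: "\<forall>s. \<phi>' t s = 0"
  have lin: "linear (\<lambda>s. \<phi>' s u)" "linear (\<lambda>a. B a b)" for u b
    using form B by (auto simp: is_tensor_form_def bilinear_def)
  obtain E :: "'a set" where E: "independent E" "span E = UNIV"
    using maximal_independent_subset[of UNIV] by (metis top.extremum_unique)
  obtain S f where S: "finite S" "S \<subseteq> E" and t: "t = (\<Sum>e\<in>S. f e \<otimes> e)"
    using tensor_basis_expansion[OF E] .
  have "f e = 0" if "e \<in> S" for e
  proof -
    have "\<phi> (f e) y = 0" for y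
    proof -
      \<comment> \<open>The element on the left is the contraction of \<open>t\<close> with \<open>\<phi>\<close> along \<open>y\<close>.\<close>
      have "B (\<Sum>e\<in>S. \<phi> (f e) y *\<^sub>R e) b = \<phi>' t (y \<otimes> b)" for b
        using form by (simp add: t is_tensor_form_def linear_sum[OF lin(1)]
            linear_sum[OF lin(2)] bilinear_simps[OF B])
      then have "(\<Sum>e\<in>S. \<phi> (f e) y *\<^sub>R e) = 0"
        using nd orth by (simp add: nondegenerate_def)
      then show ?thesis
        using independentD[OF E(1) S, of "\<lambda>e. \<phi> (f e) y"] that by blast
    qed
    then show ?thesis
      using nd by (simp add: nondegenerate_def)
  qed
  then show "t = 0"
    by (simp add: t bilinear_simps[OF bilinear_pure_tensor])
qed

section \<open>The identities on the tensor product\<close>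

lemma lie_algebra_tensor:
  fixes bracket :: "'g::real_vector \<Rightarrow> 'g \<Rightarrow> 'g"
    and bracket' :: "('g, 'a::{real_algebra, comm_ring}) tensor_product \<Rightarrow>
      ('g, 'a) tensor_product \<Rightarrow> ('g, 'a) tensor_product"
  assumes "lie_algebra bracket" and "is_tensor_bracket bracket bracket'"
  shows "lie_algebra bracket'"
proof
  interpret lie_algebra bracket
    by (rule assms)
  show bil: "bilinear bracket'"
    using assms by (simp add: is_tensor_bracket_def)
  have bracket'_pure: "bracket' (x \<otimes> a) (y \<otimes> b) = bracket x y \<otimes> (a * b)" for x y a b
    using assms by (simp add: is_tensor_bracket_def)
  note simps = bilinear_simps[OF bil] bilinear_simps[OF bilinear_bracket]
    bilinear_simps[OF bilinear_pure_tensor]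

  have skew: "bracket x y = - bracket y x" for x y
  proof -
    have "bracket (x + y) (x + y)
        = bracket x x + bracket y x + (bracket x y + bracket y y)"
      by (simp only: bilinear_ladd[OF bilinear_bracket] bilinear_radd[OF bilinear_bracket])
    then show ?thesis
      by (simp add: bracket_self eq_neg_iff_add_eq_0 add.commute)
  qed
  \<comment> \<open>The identity \<open>[t, t] = 0\<close> is quadratic in \<open>t\<close>, so its polarisation is extended instead.\<close>
  have "bracket' s t = - bracket' t s" for s t
  proof (induction s rule: tensor_induct)
    case (pure x a)
    show ?case
    proof (induction t rule: tensor_induct)
      case (pure y b)
      show ?case
        by (simp add: bracket'_pure skew[of x y] simps mult.commute)
    qed (simp_all add: simps)
  qed (simp_all add: simps)
  then have "bracket' t t + bracket' t t = 0" for t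
    by (metis eq_neg_iff_add_eq_0)
  then show "bracket' t t = 0" for t
    by (metis scaleR_2 scaleR_eq_0_iff zero_neq_numeral)

  let ?jac = "\<lambda>s t u. bracket' s (bracket' t u) + bracket' t (bracket' u s)
    + bracket' u (bracket' s t)"
  have jac_pure: "?jac (x \<otimes> a) (y \<otimes> b) (z \<otimes> c) = 0" for x a y b z c
  proof -
    have "a * (b * c) = b * (c * a)" "c * (a * b) = b * (c * a)"
      by (simp_all add: ac_simps)
    then show ?thesis
      by (simp add: bracket'_pure jacobi bilinear_lzero[OF bilinear_pure_tensor]
          flip: bilinear_ladd[OF bilinear_pure_tensor])
  qed
  show "?jac s t u = 0" for s t u
  proof (induction s rule: tensor_induct)
    case zero
    show ?case
      by (simp add: simps)
  next
    case (pure x a)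
    show ?case
    proof (induction t rule: tensor_induct)
      case zero
      show ?case
        by (simp add: simps)
    next
      case (pure y b)
      show ?case
      proof (induction u rule: tensor_induct)
        case zero
        show ?case
          by (simp add: simps)
      next
        case (pure z c)
        show ?case
          by (rule jac_pure)
      next
        case (add u v)
        have "?jac (x \<otimes> a) (y \<otimes> b) (u + v) = ?jac (x \<otimes> a) (y \<otimes> b) u + ?jac (x \<otimes> a) (y \<otimes> b) v"
          by (simp add: simps)
        then show ?case
          using add by simp
      qed
    next
      case (add t v)
      have "?jac (x \<otimes> a) (t + v) u = ?jac (x \<otimes> a) t u + ?jac (x \<otimes> a) v u"
        by (simp add: simps)
      then show ?case
        using add by simp
    qed
  next
    case (add s v)
    have "?jac (s + v) t u = ?jac s t u + ?jac v t u"
      by (simp add: simps)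
    then show ?case
      using add by simp
  qed
qed

lemma lie_algebra_complex_structure_tensor:
  fixes bracket :: "'g::real_vector \<Rightarrow> 'g \<Rightarrow> 'g"
    and bracket' :: "('g, 'a::{real_algebra, comm_ring}) tensor_product \<Rightarrow>
      ('g, 'a) tensor_product \<Rightarrow> ('g, 'a) tensor_product"
  assumes "lie_algebra_complex_structure bracket J" and "is_tensor_bracket bracket bracket'"
    and "is_tensor_complex_structure J J'"
  shows "lie_algebra_complex_structure bracket' J'"
proof -
  interpret lie_algebra_complex_structure bracket J
    by (rule assms)
  interpret tensor: lie_algebra bracket'
    by (rule lie_algebra_tensor) (use assms lie_algebra_axioms in auto)
  note bil = tensor.bilinear_bracket
  have pure: "bracket' (x \<otimes> a) (y \<otimes> b) = bracket x y \<otimes> (a * b)"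
      "J' (x \<otimes> a) = J x \<otimes> a" for x y a b
    using assms by (simp_all add: is_tensor_bracket_def is_tensor_complex_structure_def)
  have lin: "linear J'"
    using assms by (simp add: is_tensor_complex_structure_def)
  note JJ_linear = linear_compose[OF lin lin, unfolded o_def]
  let ?N = "\<lambda>s t. bracket' s t + J' (bracket' (J' s) t) + J' (bracket' s (J' t))
    - bracket' (J' s) (J' t)"
  show ?thesis
  proof (intro lie_algebra_complex_structure.intro lie_algebra_complex_structure_axioms.intro)
    show "lie_algebra bracket'"
      by (rule tensor.lie_algebra_axioms)
    show "linear J'"
      by (rule lin)
    show "J' (J' s) = - s" for s
      by (rule linear_eq_on_pure_tensors[OF JJ_linear])
        (simp_all add: linear_iff pure J_J bilinear_simps[OF bilinear_pure_tensor])
    have "bilinear ?N"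
      by (simp add: bilinear_def linear_iff bilinear_simps[OF bil] linear_add[OF lin]
          linear_scale[OF lin] algebra_simps)
    moreover have "?N (x \<otimes> a) (y \<otimes> b) = 0" for x a y b
    proof -
      have "?N (x \<otimes> a) (y \<otimes> b) = (bracket x y + J (bracket (J x) y) + J (bracket x (J y))
          - bracket (J x) (J y)) \<otimes> (a * b)"
        by (simp add: pure bilinear_ladd[OF bilinear_pure_tensor]
            bilinear_lsub[OF bilinear_pure_tensor])
      then show ?thesis
        by (simp add: integrable_J bilinear_simps[OF bilinear_pure_tensor])
    qed
    ultimately show "?N s t = 0" for s t
      by - (rule bilinear_eq_on_pure_tensors[of ?N "\<lambda>_ _. 0"],
          simp_all add: bilinear_def linear_iff)
  qed
qed

lemma nondegenerate_symmetric_form_tensor: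
  fixes \<phi> :: "'g::real_vector \<Rightarrow> 'g \<Rightarrow> real" and B :: "'a::real_vector \<Rightarrow> 'a \<Rightarrow> real"
  assumes "nondegenerate_symmetric_form \<phi>" and "nondegenerate_symmetric_form B"
    and form: "is_tensor_form \<phi> B \<phi>'"
  shows "nondegenerate_symmetric_form \<phi>'"
proof
  interpret \<phi>: nondegenerate_symmetric_form \<phi>
    by (rule assms)
  interpret B: nondegenerate_symmetric_form B
    by (rule assms)
  show bil: "bilinear \<phi>'"
    using form by (simp add: is_tensor_form_def)
  have "bilinear (\<lambda>s t. \<phi>' t s)"
    using bil by (simp add: bilinear_def)
  then show "\<phi>' s t = \<phi>' t s" for s t
    by - (rule bilinear_eq_on_pure_tensors[OF bil, of "\<lambda>s t. \<phi>' t s"],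
        use form \<phi>.form_sym B.form_sym in \<open>simp_all add: is_tensor_form_def\<close>)
  show "nondegenerate \<phi>'"
    using \<phi>.nondegenerate_form B.nondegenerate_form B.bilinear_form form
    by (rule nondegenerate_tensor_form)
qed

theorem proposition1p5:
  fixes bracket :: "'g::real_vector \<Rightarrow> 'g \<Rightarrow> 'g"
    and J :: "'g \<Rightarrow> 'g"
    and \<phi> :: "'g \<Rightarrow> 'g \<Rightarrow> real"
    and B :: "'a::{real_algebra, comm_ring} \<Rightarrow> 'a \<Rightarrow> real"
  assumes "nondegenerate_symmetric_form B"
    and "\<And>a b c. B (a * b) c = B b (a * c)"
    and "pseudo_hermitian_quadratic_lie_algebra bracket J \<phi>"
  shows
    "(\<exists>!bracket' :: ('g, 'a) tensor_product \<Rightarrow> ('g, 'a) tensor_product \<Rightarrow> ('g, 'a) tensor_product.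
        is_tensor_bracket bracket bracket') \<and>
     (\<exists>!J' :: ('g, 'a) tensor_product \<Rightarrow> ('g, 'a) tensor_product.
        is_tensor_complex_structure J J') \<and>
     (\<exists>!\<phi>'. is_tensor_form \<phi> B \<phi>') \<and>
     (\<forall>(bracket' :: ('g, 'a) tensor_product \<Rightarrow> ('g, 'a) tensor_product \<Rightarrow> ('g, 'a) tensor_product) J' \<phi>'.
        is_tensor_bracket bracket bracket' \<longrightarrow>
        is_tensor_complex_structure J J' \<longrightarrow>
        is_tensor_form \<phi> B \<phi>' \<longrightarrow>
        pseudo_hermitian_quadratic_lie_algebra bracket' J' \<phi>')"
proof -
  interpret B: nondegenerate_symmetric_form B
    by (rule assms)
  interpret pseudo_hermitian_quadratic_lie_algebra bracket J \<phi>
    by (rule assms)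
  have "pseudo_hermitian_quadratic_lie_algebra bracket' J' \<phi>'"
    if bracket': "is_tensor_bracket bracket bracket'"
      and J': "is_tensor_complex_structure J J'"
      and \<phi>': "is_tensor_form \<phi> B \<phi>'"
    for bracket' :: "('g, 'a) tensor_product \<Rightarrow> ('g, 'a) tensor_product \<Rightarrow> ('g, 'a) tensor_product"
      and J' \<phi>'
  proof -
    interpret tensor: lie_algebra_complex_structure bracket' J'
      by (rule lie_algebra_complex_structure_tensor[OF _ bracket' J']) unfold_locales
    interpret tensor: nondegenerate_symmetric_form \<phi>'
      by (rule nondegenerate_symmetric_form_tensor[OF _ _ \<phi>']) unfold_locales
    have pure: "bracket' (x \<otimes> a) (y \<otimes> b) = bracket x y \<otimes> (a * b)"
        "J' (x \<otimes> a) = J x \<otimes> a" "\<phi>' (x \<otimes> a) (y \<otimes> b) = \<phi> x y * B a b" for x y a b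
      using bracket' J' \<phi>'
      by (simp_all add: is_tensor_bracket_def is_tensor_complex_structure_def is_tensor_form_def)
    note simps = bilinear_simps[OF tensor.bilinear_bracket]
      bilinear_simps[OF tensor.bilinear_form]
    have inv_pure: "\<phi>' (bracket' (x \<otimes> a) (y \<otimes> b)) (z \<otimes> c)
        + \<phi>' (y \<otimes> b) (bracket' (x \<otimes> a) (z \<otimes> c)) = 0" for x a y b z c
      using form_invariant[of x y z] by (simp add: pure assms(2) flip: distrib_right)
    show ?thesis
    proof
      show "\<phi>' (bracket' s t) u + \<phi>' t (bracket' s u) = 0" for s t u
      proof (induction s rule: tensor_induct)
        case (pure x a)
        show ?case
        proof (induction t rule: tensor_induct)
          case (pure y b)
          show ?case
          proof (induction u rule: tensor_induct)
            case (pure z c)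
            show ?case
              by (rule inv_pure)
          qed (simp_all add: simps)
        qed (simp_all add: simps)
      qed (simp_all add: simps)
      show "\<phi>' (J' s) (J' t) = \<phi>' s t" for s t
        by (rule bilinear_eq_on_pure_tensors[OF
              bilinear_compose_linear[OF tensor.bilinear_form tensor.linear_J tensor.linear_J]
              tensor.bilinear_form])
          (simp add: pure form_J)
    qed
  qed
  then show ?thesis
    using ex1_tensor_bracket[OF bilinear_bracket] ex1_tensor_complex_structure[OF linear_J]
      ex1_tensor_form[OF bilinear_form B.bilinear_form]
    by blast
qed

end
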